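(* Let $m$ be a positive integer, and let $\Gamma=S_{2m+1}$ if $m$ is odd and $\Gamma=A_{2m+1}$ if $m$ is even. For $m+1\le k\le 2m+1$ let $c_k$ be the permutation of $\{1,\dots,2m+1\}$ defined by \[c_k(i)=\begin{cases} i+m & \text{if } i<k-m,\\ i+m+1 & \text{if } k-m\le i\le m,\\ i-m & \text{if } m<i<k,\\ i & \text{if } i=k,\\ i-m-1 & \text{if } k<i\le 2m+1,\end{cases}\] (an involution), and let $C=\{c_k\mid m+1\le k\le 2m+1\}$ and $G=\mathrm{Cay}(\Gamma,C)$. Then the set $M=\{\pi\in\Gamma\mid \pi(1)\ge m+1\}$ has $\frac{m+1}{2m+1}|\Gamma|$ elements and induces a matching in $G$.
   Context: Products of permutations are composed left to right: $(\pi\cdot\tau)(i)=\tau(\pi(i))$. For a group $\Gamma$ and $C\subseteq\Gamma$, $\mathrm{Cay}(\Gamma,C)$ is the simple undirected graph on $\Gamma$ in which $\{x,y\}$ is an edge iff $x^{-1}y\in C$, i.e. $y=x\cdot c$ for some $c\in C$. *)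

theory Defs
  imports "HOL-Algebra.Algebra"
begin

section \<open>Cayley graphs and induced matchings\<close>

text \<open>A graph is a pair of a vertex set and a set of edges, each edge being a two-element set of
  vertices.\<close>

type_synonym 'a ugraph = "'a set \<times> 'a set set"

text \<open>The library composes permutations right to left; here \<open>x \<cdot> y\<close> applies \<open>x\<close> first, so that its
  symmetric and alternating groups have to be replaced by their opposite groups.\<close>

definition opposite_group :: "('a, 'b) monoid_scheme \<Rightarrow> ('a, 'b) monoid_scheme" where
  "opposite_group G = G \<lparr> mult := (\<lambda>x y. y \<otimes>\<^bsub>G\<^esub> x) \<rparr>"

text \<open>The result is a simple undirected graph only if \<open>C\<close> is closed under inverses and does not
  contain the identity; for the connection set used below this is shown in \<open>Cay_edge_iff\<close> and
  \<open>Cay_simple\<close>.\<close>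

definition Cay :: "('a, 'b) monoid_scheme \<Rightarrow> 'a set \<Rightarrow> 'a ugraph" where
  "Cay G C = (carrier G,
     {{x, y} | x y. x \<in> carrier G \<and> y \<in> carrier G \<and> inv\<^bsub>G\<^esub> x \<otimes>\<^bsub>G\<^esub> y \<in> C})"

definition induced_subgraph :: "'a ugraph \<Rightarrow> 'a set \<Rightarrow> 'a ugraph" where
  "induced_subgraph H S = (fst H \<inter> S, {e \<in> snd H. e \<subseteq> S})"

text \<open>The edges of the induced subgraph are pairwise disjoint and cover all of its vertices, that is,
  the induced subgraph is a disjoint union of single edges without isolated vertices.\<close>

definition induces_matching :: "'a ugraph \<Rightarrow> 'a set \<Rightarrow> bool" where
  "induces_matching H S \<longleftrightarrow>
     S \<subseteq> fst H \<and>
     pairwise disjnt (snd (induced_subgraph H S)) \<and>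
     \<Union> (snd (induced_subgraph H S)) = fst (induced_subgraph H S)"


section \<open>The group, the connection set and the vertex set\<close>

definition Gam :: "nat \<Rightarrow> (nat \<Rightarrow> nat) monoid" where
  "Gam m = opposite_group (if odd m then sym_group (2 * m + 1) else alt_group (2 * m + 1))"

text \<open>Permutations of \<open>{1..2 * m + 1}\<close> are functions on all of \<^typ>\<open>nat\<close> fixing every other number.
  The truncated subtractions are exact for \<open>m + 1 \<le> k\<close>.\<close>

definition conn_perm :: "nat \<Rightarrow> nat \<Rightarrow> nat \<Rightarrow> nat" where
  "conn_perm m k i =
    (if i \<notin> {1..2 * m + 1} then i
     else if i < k - m then i + m
     else if k - m \<le> i \<and> i \<le> m then i + m + 1
     else if m < i \<and> i < k then i - m
     else if i = k then i
     else i - m - 1)"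

definition conn_set :: "nat \<Rightarrow> (nat \<Rightarrow> nat) set" where
  "conn_set m = {conn_perm m k | k. m + 1 \<le> k \<and> k \<le> 2 * m + 1}"

definition M_set :: "nat \<Rightarrow> (nat \<Rightarrow> nat) set" where
  "M_set m = {\<pi> \<in> carrier (Gam m). \<pi> 1 \<ge> m + 1}"


section \<open>Well-definedness\<close>

lemma conn_perm_involution:
  assumes "m + 1 \<le> k" "k \<le> 2 * m + 1"
  shows "conn_perm m k (conn_perm m k i) = i"
  using assms unfolding conn_perm_def by auto

lemma conn_perm_neq_id:
  assumes "m \<ge> 1" "m + 1 \<le> k" "k \<le> 2 * m + 1"
  shows "conn_perm m k \<noteq> id"
proof -
  have "conn_perm m k 1 \<noteq> 1" using assms by (auto simp: conn_perm_def)
  then show ?thesis by auto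
qed

lemma conn_perm_permutes:
  assumes "m + 1 \<le> k" "k \<le> 2 * m + 1"
  shows "conn_perm m k permutes {1..2 * m + 1}"
  unfolding permutes_def
proof (intro conjI allI impI)
  show "conn_perm m k x = x" if "x \<notin> {1..2 * m + 1}" for x
    using that by (auto simp: conn_perm_def)
  show "\<exists>!x. conn_perm m k x = y" for y
    using conn_perm_involution[OF assms] by metis
qed

lemma evenperm_conn_perm:
  assumes k: "m + 1 \<le> k" "k \<le> 2 * m + 1"
  shows "evenperm (conn_perm m k) \<longleftrightarrow> even m"
proof -
  define p where "p = (\<lambda>j x. if x \<le> j \<or> conn_perm m k x \<le> j then conn_perm m k x else x)"
  have "permutation (p j) \<and> (evenperm (p j) \<longleftrightarrow> even j)" if "j \<le> m" for j
    using that
  proof (induction j)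
    case 0
    have "p 0 = id"
      using k by (auto simp: p_def conn_perm_def fun_eq_iff)
    then show ?case by simp
  next
    case (Suc j)
    let ?t = "transpose (Suc j) (conn_perm m k (Suc j))"
    have big: "conn_perm m k (Suc j) > m"
      using k Suc.prems by (auto simp: conn_perm_def)
    have eq: "p (Suc j) = ?t \<circ> p j"
    proof
      fix x
      have inv: "conn_perm m k (conn_perm m k y) = y" for y
        using conn_perm_involution[OF k] .
      have low: "conn_perm m k y > m" if "1 \<le> y" "y \<le> m" for y
        using k that by (auto simp: conn_perm_def)
      have zero: "conn_perm m k y = 0 \<longleftrightarrow> y = 0" for y
        using k by (auto simp: conn_perm_def)
      consider "x = Suc j" | "x = conn_perm m k (Suc j)" "x \<noteq> Suc j"
        | "x \<noteq> Suc j" "x \<noteq> conn_perm m k (Suc j)" by blast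
      then show "p (Suc j) x = (?t \<circ> p j) x"
      proof cases
        case 1
        then show ?thesis using big Suc.prems by (auto simp: p_def)
      next
        case 2
        then show ?thesis using big Suc.prems inv by (auto simp: p_def)
      next
        case 3
        then have "conn_perm m k x \<noteq> Suc j" "conn_perm m k x \<noteq> conn_perm m k (Suc j)"
          using inv by metis+
        with 3 show ?thesis
          by (auto simp: p_def le_Suc_eq transpose_def)
      qed
    qed
    have IH: "permutation (p j)" "evenperm (p j) \<longleftrightarrow> even j"
      using Suc by auto
    have "permutation ?t" by (rule permutation_swap_id)
    moreover have "\<not> evenperm ?t"
      using big Suc.prems by (simp add: evenperm_swap)
    ultimately show ?case
      unfolding eq using IH by (metis even_Suc evenperm_comp permutation_compose)
  qed
  from this[of m] have "evenperm (p m) \<longleftrightarrow> even m" by simp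
  moreover have "p m = conn_perm m k"
    using k by (auto simp: p_def conn_perm_def fun_eq_iff)
  ultimately show ?thesis by simp
qed

lemma conn_perm_in_Gam:
  assumes "m + 1 \<le> k" "k \<le> 2 * m + 1"
  shows "conn_perm m k \<in> carrier (Gam m)"
  using conn_perm_permutes[OF assms] evenperm_conn_perm[OF assms]
  by (simp add: Gam_def opposite_group_def sym_group_carrier alt_group_carrier)

lemma conn_set_subset_Gam: "conn_set m \<subseteq> carrier (Gam m)"
  using conn_perm_in_Gam by (auto simp: conn_set_def)

lemma opposite_group_is_group:
  assumes "group G"
  shows "group (opposite_group G)"
proof -
  interpret group G by fact
  show ?thesis
    by (rule groupI) (auto simp: opposite_group_def m_assoc intro: r_inv_ex)
qed

lemma group_Gam: "group (Gam m)"
  unfolding Gam_def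
  by (auto intro!: opposite_group_is_group sym_group_is_group alt_group_is_group)

lemma Gam_mult: "(\<pi> \<otimes>\<^bsub>Gam m\<^esub> \<tau>) i = \<tau> (\<pi> i)"
  by (simp add: Gam_def opposite_group_def sym_group_mult alt_group_mult)

lemma Gam_one: "\<one>\<^bsub>Gam m\<^esub> = id"
  by (simp add: Gam_def opposite_group_def sym_group_one alt_group_one)

lemma inv_conn_set:
  assumes "x \<in> conn_set m"
  shows "inv\<^bsub>Gam m\<^esub> x = x"
proof -
  interpret group "Gam m" by (rule group_Gam)
  have "x \<otimes>\<^bsub>Gam m\<^esub> x = \<one>\<^bsub>Gam m\<^esub>"
    using assms conn_perm_involution by (auto simp: conn_set_def Gam_mult Gam_one fun_eq_iff)
  then show ?thesis
    using assms conn_set_subset_Gam inv_equality by blast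
qed

lemma Cay_edge_iff:
  assumes "x \<in> carrier (Gam m)" "y \<in> carrier (Gam m)"
  shows "{x, y} \<in> snd (Cay (Gam m) (conn_set m)) \<longleftrightarrow> inv\<^bsub>Gam m\<^esub> x \<otimes>\<^bsub>Gam m\<^esub> y \<in> conn_set m"
proof -
  interpret group "Gam m" by (rule group_Gam)
  have "inv\<^bsub>Gam m\<^esub> b \<otimes>\<^bsub>Gam m\<^esub> a \<in> conn_set m"
    if "inv\<^bsub>Gam m\<^esub> a \<otimes>\<^bsub>Gam m\<^esub> b \<in> conn_set m" "a \<in> carrier (Gam m)" "b \<in> carrier (Gam m)" for a b
    using inv_conn_set[OF that(1)] that by (simp add: inv_mult_group)
  then show ?thesis
    using assms by (auto simp: Cay_def doubleton_eq_iff)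
qed

lemma Cay_simple:
  assumes "m \<ge> 1" "e \<in> snd (Cay (Gam m) (conn_set m))"
  shows "e \<subseteq> carrier (Gam m)" "card e = 2"
proof -
  interpret group "Gam m" by (rule group_Gam)
  obtain x y where e: "e = {x, y}" "x \<in> carrier (Gam m)" "y \<in> carrier (Gam m)"
      "inv\<^bsub>Gam m\<^esub> x \<otimes>\<^bsub>Gam m\<^esub> y \<in> conn_set m"
    using assms(2) by (auto simp: Cay_def)
  have "\<one>\<^bsub>Gam m\<^esub> \<notin> conn_set m"
    using conn_perm_neq_id[OF assms(1)] unfolding conn_set_def Gam_one by force
  then have "x \<noteq> y" using e by auto
  with e show "e \<subseteq> carrier (Gam m)" "card e = 2" by auto
qed

end

theory Submission
  imports Defs
begin

text \<open>Right multiplication by \<open>c\<^sub>k\<close> permutes \<open>\<Gamma>\<close> and carries the fibre \<open>\<pi>(1) = i\<close> to the fibre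
  \<open>\<pi>(1) = c\<^sub>k(i)\<close>. Since \<open>c\<^bsub>2m+1\<^esub>\<close> swaps \<open>i\<close> with \<open>i + m\<close> and \<open>c\<^bsub>m+1\<^esub>\<close> swaps \<open>i\<close> with \<open>i + m + 1\<close>
  for \<open>1 \<le> i \<le> m\<close>, all \<open>2m + 1\<close> fibres have the same size, which gives the cardinality.
  Moreover, \<open>c\<^sub>k\<close> maps every \<open>i \<ge> m + 1\<close> other than its fixed point \<open>k\<close> to a value at most \<open>m\<close>; so the
  only neighbour in \<open>M\<close> of \<open>\<pi> \<in> M\<close> is \<open>\<pi> \<cdot> c\<^sub>k\<close> with \<open>k = \<pi>(1)\<close>.\<close>

definition fibre :: "nat \<Rightarrow> nat \<Rightarrow> (nat \<Rightarrow> nat) set" where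
  "fibre m i = {\<pi> \<in> carrier (Gam m). \<pi> 1 = i}"

lemma carrier_Gam_permutes:
  assumes "\<pi> \<in> carrier (Gam m)"
  shows "\<pi> permutes {1..2 * m + 1}"
  using assms
  by (auto simp: Gam_def opposite_group_def sym_group_carrier alt_group_carrier split: if_splits)

lemma finite_carrier_Gam: "finite (carrier (Gam m))"
  by (rule finite_subset[OF _ finite_permutations[of "{1..2 * m + 1}"]])
    (auto dest: carrier_Gam_permutes)

lemma carrier_Gam_apply_1:
  assumes "\<pi> \<in> carrier (Gam m)"
  shows "\<pi> 1 \<in> {1..2 * m + 1}"
  using permutes_in_image[OF carrier_Gam_permutes[OF assms], of 1] by simp

lemma Gam_mult_eq_comp: "\<pi> \<otimes>\<^bsub>Gam m\<^esub> \<tau> = \<tau> \<circ> \<pi>"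
  by (simp add: fun_eq_iff Gam_mult)

lemma conn_perm_comp_in_Gam:
  assumes "m + 1 \<le> k" "k \<le> 2 * m + 1" "\<pi> \<in> carrier (Gam m)"
  shows "conn_perm m k \<circ> \<pi> \<in> carrier (Gam m)"
proof -
  interpret group "Gam m" by (rule group_Gam)
  show ?thesis
    using m_closed[OF assms(3) conn_perm_in_Gam[OF assms(1,2)]] by (simp add: Gam_mult_eq_comp)
qed

text \<open>Because \<open>conn_perm m k\<close> is an involution, composing with it is its own
  inverse, so one map witnesses both directions of the bijection.\<close>

lemma card_fibre_conn_perm:
  assumes k: "m + 1 \<le> k" "k \<le> 2 * m + 1"
  shows "card (fibre m (conn_perm m k i)) = card (fibre m i)"
proof (rule bij_betw_same_card)
  show "bij_betw ((\<circ>) (conn_perm m k)) (fibre m (conn_perm m k i)) (fibre m i)"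
    by (rule bij_betw_byWitness[where f' = "(\<circ>) (conn_perm m k)"])
      (auto simp: fibre_def fun_eq_iff conn_perm_involution[OF k] conn_perm_comp_in_Gam[OF k])
qed

text \<open>The involutions for \<open>k = 2 * m + 1\<close> and \<open>k = m + 1\<close> alternate
  along the path m + 1, 1, m + 2, 2, ..., m, 2m + 1, which visits every possible value of
  \<pi>(1).\<close>

lemma card_fibre:
  assumes "j \<in> {1..2 * m + 1}"
  shows "card (fibre m j) = card (fibre m (m + 1))"
proof -
  have left: "card (fibre m (i + m)) = card (fibre m i)" if "1 \<le> i" "i \<le> m" for i
    using card_fibre_conn_perm[of m "2 * m + 1" i] that by (simp add: conn_perm_def)
  have right: "card (fibre m (i + m + 1)) = card (fibre m i)" if "1 \<le> i" "i \<le> m" for i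
    using card_fibre_conn_perm[of m "m + 1" i] that by (simp add: conn_perm_def)
  have upper: "card (fibre m (i + m + 1)) = card (fibre m (m + 1))" if "i \<le> m" for i
    using that
  proof (induction i)
    case (Suc i)
    then show ?case
      \<comment> \<open>Two moves along the path: from i + m + 1 = \<open>Suc i + m\<close> down to
        \<open>Suc i\<close>, then up to \<open>Suc i + m + 1\<close>.\<close>
      using left[of "Suc i"] right[of "Suc i"] by simp
  qed simp
  show ?thesis
  proof (cases "j \<le> m")
    case True
    then show ?thesis using right[of j] upper[of j] assms by simp
  next
    case False
    then show ?thesis using upper[of "j - m - 1"] assms by simp
  qed
qed

lemma card_Union_fibres:
  assumes "J \<subseteq> {1..2 * m + 1}"
  shows "card (\<Union>j\<in>J. fibre m j) = card J * card (fibre m (m + 1))"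
proof -
  have "card (\<Union>j\<in>J. fibre m j) = (\<Sum>j\<in>J. card (fibre m j))"
    using finite_subset[OF assms] finite_carrier_Gam
    by (intro card_UN_disjoint) (auto simp: fibre_def)
  also have "\<dots> = (\<Sum>j\<in>J. card (fibre m (m + 1)))"
    using assms by (intro sum.cong refl card_fibre) auto
  finally show ?thesis by simp
qed

text \<open>\<open>M_set m\<close> consists of m + 1 of the 2m + 1 equal fibres. Multiplying out the
  denominator keeps the identity in the naturals.\<close>

lemma card_M_set: "(2 * m + 1) * card (M_set m) = (m + 1) * order (Gam m)"
proof -
  have "carrier (Gam m) = (\<Union>j\<in>{1..2 * m + 1}. fibre m j)"
    using carrier_Gam_apply_1 by (auto simp: fibre_def)
  then have "order (Gam m) = (2 * m + 1) * card (fibre m (m + 1))"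
    using card_Union_fibres[of "{1..2 * m + 1}" m] by (simp add: order_def)
  moreover have "M_set m = (\<Union>j\<in>{m + 1..2 * m + 1}. fibre m j)"
    using carrier_Gam_apply_1 by (fastforce simp: fibre_def M_set_def)
  then have "card (M_set m) = (m + 1) * card (fibre m (m + 1))"
    using card_Union_fibres[of "{m + 1..2 * m + 1}" m] by simp
  ultimately show ?thesis by (simp only: mult_ac)
qed

lemma conn_perm_ge_iff:
  assumes "m + 1 \<le> k" "k \<le> 2 * m + 1" "m + 1 \<le> i" "i \<le> 2 * m + 1"
  shows "m + 1 \<le> conn_perm m k i \<longleftrightarrow> i = k"
  using assms by (auto simp: conn_perm_def)

definition partner :: "nat \<Rightarrow> (nat \<Rightarrow> nat) \<Rightarrow> nat \<Rightarrow> nat" where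
  "partner m \<pi> = conn_perm m (\<pi> 1) \<circ> \<pi>"

lemma M_setD:
  assumes "\<pi> \<in> M_set m"
  shows "\<pi> \<in> carrier (Gam m)" "m + 1 \<le> \<pi> 1" "\<pi> 1 \<le> 2 * m + 1"
  using assms carrier_Gam_apply_1[of \<pi> m] by (auto simp: M_set_def)

lemma partner_in_M_set:
  assumes "\<pi> \<in> M_set m"
  shows "partner m \<pi> \<in> M_set m"
  using M_setD[OF assms] conn_perm_comp_in_Gam[of m "\<pi> 1" \<pi>] conn_perm_ge_iff[of m "\<pi> 1" "\<pi> 1"]
  by (simp add: M_set_def partner_def)

text \<open>\<open>conn_perm m k\<close> fixes k, so \<pi> and its partner agree at 1 and the same
  involution is applied twice.\<close>

lemma partner_partner:
  assumes "\<pi> \<in> M_set m"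
  shows "partner m (partner m \<pi>) = \<pi>"
proof -
  have "conn_perm m (\<pi> 1) (\<pi> 1) = \<pi> 1"
    using M_setD[OF assms] by (simp add: conn_perm_def)
  then show ?thesis
    using M_setD[OF assms] by (simp add: partner_def fun_eq_iff conn_perm_involution)
qed

lemma Cay_edge_M_set_iff:
  assumes x: "x \<in> M_set m" and y: "y \<in> M_set m"
  shows "{x, y} \<in> snd (Cay (Gam m) (conn_set m)) \<longleftrightarrow> y = partner m x"
proof -
  interpret group "Gam m" by (rule group_Gam)
  have "inv\<^bsub>Gam m\<^esub> x \<otimes>\<^bsub>Gam m\<^esub> y = conn_perm m k \<longleftrightarrow> y = conn_perm m k \<circ> x"
    if "m + 1 \<le> k" "k \<le> 2 * m + 1" for k
    using inv_solve_left'[OF conn_perm_in_Gam[OF that] M_setD(1)[OF x] M_setD(1)[OF y]]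
    unfolding Gam_mult_eq_comp[of m x "conn_perm m k"] .
  then have "inv\<^bsub>Gam m\<^esub> x \<otimes>\<^bsub>Gam m\<^esub> y \<in> conn_set m
      \<longleftrightarrow> (\<exists>k. m + 1 \<le> k \<and> k \<le> 2 * m + 1 \<and> y = conn_perm m k \<circ> x)"
    unfolding conn_set_def by blast
  \<comment> \<open>Evaluating at 1, \<open>conn_perm m k (x 1) = y 1\<close> is at least m + 1,
    which forces k = \<open>x 1\<close>.\<close>
  also have "\<dots> \<longleftrightarrow> y = partner m x"
    using M_setD(2,3)[OF x] M_setD(2)[OF y] conn_perm_ge_iff[of m _ "x 1"]
    unfolding partner_def by (metis comp_apply)
  finally show ?thesis
    using Cay_edge_iff M_setD(1)[OF x] M_setD(1)[OF y] by simp
qed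

text \<open>Writing the edges as the orbits of \<open>partner m\<close> reduces the matching
  property to \<open>partner m\<close> being an involution on \<open>M_set m\<close>.\<close>

lemma induced_edges_M_set:
  "snd (induced_subgraph (Cay (Gam m) (conn_set m)) (M_set m)) = (\<lambda>x. {x, partner m x}) ` M_set m"
  (is "?E = _")
proof
  show "?E \<subseteq> (\<lambda>x. {x, partner m x}) ` M_set m"
  proof
    fix e assume e: "e \<in> ?E"
    then obtain x y where xy: "e = {x, y}"
      by (auto simp: induced_subgraph_def Cay_def)
    with e have "x \<in> M_set m" "y \<in> M_set m" "{x, y} \<in> snd (Cay (Gam m) (conn_set m))"
      by (auto simp: induced_subgraph_def)
    with xy show "e \<in> (\<lambda>x. {x, partner m x}) ` M_set m"
      using Cay_edge_M_set_iff by blast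
  qed
  show "(\<lambda>x. {x, partner m x}) ` M_set m \<subseteq> ?E"
    using partner_in_M_set Cay_edge_M_set_iff by (auto simp: induced_subgraph_def)
qed

lemma induces_matching_M_set: "induces_matching (Cay (Gam m) (conn_set m)) (M_set m)"
proof -
  have sub: "M_set m \<subseteq> fst (Cay (Gam m) (conn_set m))"
    by (auto simp: M_set_def Cay_def)
  have "pairwise disjnt ((\<lambda>x. {x, partner m x}) ` M_set m)"
  proof (rule pairwiseI)
    fix e f
    assume ef: "e \<in> (\<lambda>x. {x, partner m x}) ` M_set m" "f \<in> (\<lambda>x. {x, partner m x}) ` M_set m" "e \<noteq> f"
    \<comment> \<open>An edge is recovered from either of its vertices, so edges that share a vertex
      coincide.\<close>
    have determined: "g = {z, partner m z}"
      if "g \<in> (\<lambda>x. {x, partner m x}) ` M_set m" "z \<in> g" for g z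
      using that partner_partner by fastforce
    show "disjnt e f"
      using ef determined unfolding disjnt_iff by metis
  qed
  moreover have "\<Union> ((\<lambda>x. {x, partner m x}) ` M_set m) = M_set m"
    using partner_in_M_set by auto
  ultimately show ?thesis
    using sub unfolding induces_matching_def induced_edges_M_set
    by (auto simp: induced_subgraph_def)
qed

theorem theorem4p1:
  fixes m :: nat
  assumes "m > 0"
  shows "real (card (M_set m)) = (real m + 1) / (2 * real m + 1) * real (order (Gam m))
    \<and> induces_matching (Cay (Gam m) (conn_set m)) (M_set m)"
proof
  have "(2 * real m + 1) * real (card (M_set m)) = (real m + 1) * real (order (Gam m))"
    using arg_cong[OF card_M_set[of m], of real] by (simp add: algebra_simps)
  then show "real (card (M_set m)) = (real m + 1) / (2 * real m + 1) * real (order (Gam m))"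
    by (simp add: field_simps)
qed (rule induces_matching_M_set)

end
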